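(* For all integers $m\geq 0$ and $n\geq 1$, \[ \overline{M}(m,n)\geq \overline{M}(m,n-1)\qquad\text{and}\qquad \overline{M2}(m,n)\geq \overline{M2}(m,n-1). \]
   Context: Notation: $(a;q)_\infty=\prod_{j\geq 0}(1-aq^j)$. An overpartition of $n$ is a partition of $n$ in which the first occurrence of each part size may be overlined. The crank of an ordinary partition is its largest part if it has no parts equal to $1$, and otherwise the number of parts larger than the number of ones minus the number of ones. The first residual crank of an overpartition is the crank of the partition formed by its non-overlined parts; the second residual crank is the crank of the partition formed by its even non-overlined parts each divided by two. $\overline{M}(m,n)$ (resp. $\overline{M2}(m,n)$) is the number of overpartitions of $n$ with first (resp. second) residual crank $m$, with the modification that when the relevant ordinary partition is the single part $1$, the overpartition contributes $-1$ to crank $0$ and $+1$ to each of cranks $-1$ and $1$. Equivalently, \[ \sum_{m,n}\overline{M}(m,n)z^mq^n=\frac{(-q;q)_\infty(q;q)_\infty}{(zq;q)_\infty(q/z;q)_\infty},\qquad \sum_{m,n}\overline{M2}(m,n)z^mq^n=\frac{(-q;q)_\infty(q;q)_\infty}{(q;q^2)_\infty(zq;q)_\infty(q/z;q)_\infty}. \]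
   Formalization: The first inequality is false at (m,n)=(0,1), where M̄(0,0)=1 and M̄(0,1)=0, so exactly that pair is excluded; M2 is taken by its combinatorial definition, since the displayed product for it disagrees with that definition at q^1. *)

theory Defs
  imports Main "HOL-Library.Multiset"
begin

definition partitions :: "nat \<Rightarrow> nat multiset set" where
  "partitions n = {P. 0 \<notin># P \<and> sum_mset P = n}"

text \<open>An overpartition is a pair \<open>(P, S)\<close>: the underlying partition \<open>P\<close> and the set \<open>S\<close>
  of those part sizes whose first occurrence is overlined.\<close>

definition overpartitions :: "nat \<Rightarrow> (nat multiset \<times> nat set) set" where
  "overpartitions n = {(P, S). P \<in> partitions n \<and> S \<subseteq> set_mset P}"

definition nonoverlined :: "nat multiset \<times> nat set \<Rightarrow> nat multiset" where
  "nonoverlined = (\<lambda>(P, S). P - mset_set S)"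

definition half_even_nonoverlined :: "nat multiset \<times> nat set \<Rightarrow> nat multiset" where
  "half_even_nonoverlined \<pi> = {# k div 2. k \<in># filter_mset even (nonoverlined \<pi>) #}"

text \<open>The largest part of the empty partition is taken to be 0, so its crank is 0.\<close>

definition crank :: "nat multiset \<Rightarrow> int" where
  "crank P =
    (if 1 \<notin># P then int (Max (insert 0 (set_mset P)))
     else int (size {# k \<in># P. k > count P 1 #}) - int (count P 1))"

text \<open>The contribution of a partition to crank \<open>m\<close>. The partition with the single part 1 is
  counted with weights \<open>z - 1 + 1/z\<close>, as the coefficient of \<open>q\<close> in
  \<open>(q;q)\<^sub>\<infinity> / ((zq;q)\<^sub>\<infinity> (q/z;q)\<^sub>\<infinity>)\<close> demands.\<close>

definition crank_weight :: "int \<Rightarrow> nat multiset \<Rightarrow> int" where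
  "crank_weight m P =
    (if P = {#1#} then (if m = 0 then -1 else if m = -1 \<or> m = 1 then 1 else 0)
     else (if crank P = m then 1 else 0))"

definition Mbar :: "int \<Rightarrow> nat \<Rightarrow> int" where
  "Mbar m n = (\<Sum>\<pi>\<in>overpartitions n. crank_weight m (nonoverlined \<pi>))"

definition M2bar :: "int \<Rightarrow> nat \<Rightarrow> int" where
  "M2bar m n = (\<Sum>\<pi>\<in>overpartitions n. crank_weight m (half_even_nonoverlined \<pi>))"

lemma size_le_sum_mset: "0 \<notin># P \<Longrightarrow> size P \<le> sum_mset P" for P :: "nat multiset"
  by (induction P) (auto simp: Suc_le_eq)

lemma finite_partitions: "finite (partitions n)"
proof (rule finite_subset)
  show "partitions n \<subseteq> mset ` {xs. set xs \<subseteq> {..n} \<and> length xs \<le> n}"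
  proof
    fix P assume P: "P \<in> partitions n"
    obtain xs where xs: "P = mset xs" by (metis ex_mset)
    have "set xs \<subseteq> {..n}"
    proof
      fix x assume "x \<in> set xs"
      then obtain Q where "P = add_mset x Q" using xs by (metis mset_add set_mset_mset)
      then show "x \<in> {..n}" using P by (auto simp: partitions_def)
    qed
    moreover have "length xs \<le> n"
      using P size_le_sum_mset[of P] xs by (auto simp: partitions_def)
    ultimately show "P \<in> mset ` {xs. set xs \<subseteq> {..n} \<and> length xs \<le> n}" using xs by blast
  qed
qed (simp add: finite_lists_length_le)

lemma finite_overpartitions: "finite (overpartitions n)"
proof -
  have "overpartitions n = Sigma (partitions n) (\<lambda>P. Pow (set_mset P))"
    by (auto simp: overpartitions_def)
  then show ?thesis by (simp add: finite_partitions)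
qed

lemma partitions_0: "partitions 0 = {{#}}"
proof -
  have "P = {#}" if "0 \<notin># P" "sum_mset P = 0" for P :: "nat multiset"
    using size_le_sum_mset[OF that(1)] that(2) by simp
  then show ?thesis by (auto simp: partitions_def)
qed

lemma partitions_1: "partitions 1 = {{#1#}}"
proof -
  have "P = {#1#}" if P: "0 \<notin># P" "sum_mset P = 1" for P :: "nat multiset"
  proof (cases P)
    case (add x Q)
    then have "x > 0" "x + sum_mset Q = 1" "0 \<notin># Q" using P by auto
    then have "x = 1" "size Q = 0" using size_le_sum_mset[of Q] by linarith+
    then show ?thesis using add by simp
  qed (use P in simp)
  then show ?thesis by (auto simp: partitions_def)
qed

text \<open>The first inequality fails at \<open>m = 0\<close>, \<open>n = 1\<close>, so this pair has to be excluded: the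
  coefficients of \<open>q\<^sup>0\<close> and \<open>q\<^sup>1\<close> in the generating function are \<open>1\<close> and \<open>z + 1/z\<close>.\<close>

lemma Mbar_0_1_less: "Mbar 0 1 < Mbar 0 0"
proof -
  have 0: "overpartitions 0 = {({#}, {})}"
    by (auto simp: overpartitions_def partitions_0)
  have 1: "overpartitions 1 = {({#1#}, {}), ({#1#}, {1})}"
    unfolding overpartitions_def partitions_1 by auto
  have "Mbar 0 0 = 1"
    unfolding Mbar_def 0 by (simp add: nonoverlined_def crank_weight_def crank_def)
  moreover have "Mbar 0 1 = 0"
    unfolding Mbar_def 1 by (simp add: nonoverlined_def crank_weight_def crank_def)
  ultimately show ?thesis by simp
qed

end

theory Submission
  imports Defs
begin

text \<open>Let \<open>D\<close> count partitions into distinct parts, and let \<open>c\<^sub>m\<close> be the crank counts of ordinary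
  partitions. The overlined parts are independent of the rest, so the first residual crank counts
  are the convolution of \<open>D\<close> with \<open>c\<^sub>m\<close>, and their differences are the convolution of
  \<open>d(j) = D(j) - D(j - 1) \<ge> 0\<close> with \<open>c\<^sub>m\<close>. The only negative crank count is \<open>c\<^sub>0(1) = -1\<close>. It is
  compensated by \<open>c\<^sub>0(0) = 1\<close> and \<open>c\<^sub>0(k) \<ge> 1\<close> for \<open>k \<ge> 3\<close>, the latter witnessed by the
  partition \<open>(k - 1, 1)\<close>: the sum of \<open>d(n - k)\<close> over \<open>k \<ge> 3\<close> telescopes to \<open>D(n - 3)\<close>, and
  \<open>D(n - 1) \<le> D(n - 2) + D(n - 3)\<close>.

  For the second residual crank, \<open>D\<close> is replaced by the number \<open>B\<close> of pairs of a partition into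
  odd parts and one into distinct parts, convolved with \<open>c\<^sub>m\<close> at \<open>q\<^sup>2\<close>. Here \<open>B(j) - B(j - 1)\<close>
  counts the pairs without an odd part 1, and raising the largest distinct part by 2 shows that
  this does not decrease from \<open>j - 2\<close> to \<open>j\<close>, so the term of \<open>c\<^sub>0(0)\<close> already outweighs that of
  \<open>c\<^sub>0(1)\<close>.\<close>

section \<open>Families counted by the convolutions\<close>

text \<open>The index is an integer so that the counts vanish at negative arguments and convolutions
  can be shifted without boundary terms.\<close>

definition distinct_parts :: "int \<Rightarrow> nat set set" where
  "distinct_parts j = {S. finite S \<and> 0 \<notin> S \<and> int (\<Sum>S) = j}"

text \<open>These are the non-overlined odd parts together with all overlined parts, which may have
  either parity. Oddness already keeps 0 out of \<open>Q\<close>.\<close>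

definition odd_distinct_pairs :: "int \<Rightarrow> (nat multiset \<times> nat set) set" where
  "odd_distinct_pairs j =
    {(Q, S). (\<forall>k\<in>#Q. odd k) \<and> finite S \<and> 0 \<notin> S \<and> int (sum_mset Q + \<Sum>S) = j}"

definition crank_total :: "int \<Rightarrow> nat \<Rightarrow> int" where
  "crank_total m k = (\<Sum>P\<in>partitions k. crank_weight m P)"

lemma distinct_parts_neg: "j < 0 \<Longrightarrow> distinct_parts j = {}"
  unfolding distinct_parts_def by (auto simp del: of_nat_sum)

lemma odd_distinct_pairs_neg: "j < 0 \<Longrightarrow> odd_distinct_pairs j = {}"
  unfolding odd_distinct_pairs_def by (auto simp del: of_nat_sum of_nat_add)

lemma subset_atMost_sum: "finite S \<Longrightarrow> S \<subseteq> {..\<Sum>S}" for S :: "nat set"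
  by (auto intro: member_le_sum[of _ S "\<lambda>x. x", simplified])

lemma finite_distinct_parts: "finite (distinct_parts j)"
proof (rule finite_subset)
  show "distinct_parts j \<subseteq> Pow {..nat j}"
    using subset_atMost_sum unfolding distinct_parts_def by (force simp del: of_nat_sum)
qed simp

lemma finite_odd_distinct_pairs: "finite (odd_distinct_pairs j)"
proof (rule finite_subset)
  show "odd_distinct_pairs j \<subseteq> (\<Union>k\<le>nat j. partitions k) \<times> Pow {..nat j}"
  proof
    fix x assume "x \<in> odd_distinct_pairs j"
    then obtain Q S where x: "x = (Q, S)" and Q: "\<forall>k\<in>#Q. odd k" and S: "finite S"
      and j: "int (sum_mset Q + \<Sum>S) = j"
      unfolding odd_distinct_pairs_def by blast
    from j have j': "nat j = sum_mset Q + \<Sum>S" by linarith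
    have "Q \<in> partitions (sum_mset Q)" using Q by (auto simp: partitions_def)
    moreover have "sum_mset Q \<le> nat j" using j' by simp
    moreover have "S \<subseteq> {..nat j}" using subset_atMost_sum[OF S] j' by force
    ultimately show "x \<in> (\<Union>k\<le>nat j. partitions k) \<times> Pow {..nat j}"
      using x by blast
  qed
qed (simp add: finite_partitions)

section \<open>Convolution formulas\<close>

text \<open>The pairs are grouped by the weight \<open>k\<close> of \<open>Q\<close>. As
  \<open>X\<close> is empty at negative arguments and \<open>t \<ge> 1\<close>, only
  \<open>k \<le> n\<close> occurs. The two uses are \<open>t = 1\<close> and, for halved even parts,
  \<open>t = 2\<close>.\<close>

lemma sum_Sigma_partitions:
  fixes X :: "int \<Rightarrow> 'b set" and f :: "nat multiset \<Rightarrow> int" and t n :: nat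
  assumes fin: "\<And>j. finite (X j)" and neg: "\<And>j. j < 0 \<Longrightarrow> X j = {}" and t: "t \<ge> 1"
  shows "(\<Sum>y\<in>{(Q, x). 0 \<notin># Q \<and> x \<in> X (int n - int t * int (sum_mset Q))}. f (fst y)) =
    (\<Sum>k\<le>n. int (card (X (int n - int t * int k))) * (\<Sum>Q\<in>partitions k. f Q))"
proof -
  have eq: "{(Q, x). 0 \<notin># Q \<and> x \<in> X (int n - int t * int (sum_mset Q))} =
    Sigma (\<Union>k\<le>n. partitions k) (\<lambda>Q. X (int n - int t * int (sum_mset Q)))" (is "?L = ?R")
  proof (intro set_eqI iffI)
    fix y assume "y \<in> ?L"
    then obtain Q x where y: "y = (Q, x)" "0 \<notin># Q" "x \<in> X (int n - int t * int (sum_mset Q))"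
      by blast
    then have "int n - int t * int (sum_mset Q) \<ge> 0" using neg by (metis empty_iff not_less)
    then have "t * sum_mset Q \<le> n" by (metis diff_ge_0_iff_ge of_nat_le_iff of_nat_mult)
    then have "sum_mset Q \<le> n" using t by (metis le_trans mult_le_mono1 nat_mult_1)
    then show "y \<in> ?R" using y by (auto simp: partitions_def)
  qed (auto simp: partitions_def)
  have "(\<Sum>y\<in>?L. f (fst y)) =
      (\<Sum>Q\<in>(\<Union>k\<le>n. partitions k). \<Sum>x\<in>X (int n - int t * int (sum_mset Q)). f Q)"
    unfolding eq by (subst sum.Sigma) (auto simp: fin finite_partitions case_prod_unfold)
  also have "\<dots> = (\<Sum>k\<le>n. \<Sum>Q\<in>partitions k. \<Sum>x\<in>X (int n - int t * int (sum_mset Q)). f Q)"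
    by (rule sum.UNION_disjoint) (auto simp: finite_partitions, auto simp: partitions_def)
  also have "\<dots> = (\<Sum>k\<le>n. int (card (X (int n - int t * int k))) * (\<Sum>Q\<in>partitions k. f Q))"
    by (intro sum.cong refl) (auto simp: sum_distrib_left partitions_def)
  finally show ?thesis .
qed

lemma sum_mset_mset_set: "sum_mset (mset_set S) = \<Sum>S" for S :: "nat set"
  by (simp add: sum_unfold_sum_mset)

lemma mset_set_subseteq: "S \<subseteq> set_mset P \<Longrightarrow> mset_set S \<subseteq># P"
  by (meson finite_set_mset mset_set_set_mset_msubset subset_mset.trans
      subset_imp_msubset_mset_set)

text \<open>Removing one copy of each overlined size is undone by adding \<open>mset_set S\<close>.
  Since every element of \<open>S\<close> occurs in \<open>Q + mset_set S\<close>, any partition may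
  be combined with any set.\<close>

lemma Mbar_convolution:
  "Mbar m n = (\<Sum>k\<le>n. int (card (distinct_parts (int n - int k))) * crank_total m k)"
proof -
  have "Mbar m n = (\<Sum>y\<in>{(Q, S). 0 \<notin># Q \<and> S \<in> distinct_parts (int n - int 1 * int (sum_mset Q))}.
      crank_weight m (fst y))"
    unfolding Mbar_def
  proof (rule sum.reindex_bij_witness[where
        j = "\<lambda>(P, S). (P - mset_set S, S)" and i = "\<lambda>(Q, S). (Q + mset_set S, S)"], goal_cases)
    case (1 a)
    then show ?case by (auto simp: overpartitions_def mset_set_subseteq)
  next
    case (2 a)
    then obtain P S where a: "a = (P, S)" "0 \<notin># P" "sum_mset P = n" "S \<subseteq> set_mset P"
      by (auto simp: overpartitions_def partitions_def)
    have S: "finite S" "0 \<notin> S" using a by (auto intro: finite_subset)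
    have "sum_mset P = sum_mset (P - mset_set S) + \<Sum>S"
      using mset_set_subseteq[OF a(4)]
      by (metis subset_mset.diff_add sum_mset.union sum_mset_mset_set)
    then have "int (\<Sum>S) = int n - int 1 * int (sum_mset (P - mset_set S))"
      using a(3) by linarith
    then show ?case using a S
      by (auto simp: distinct_parts_def simp del: of_nat_sum dest: in_diffD)
  next
    case (3 b)
    then show ?case by auto
  next
    case (4 b)
    then obtain Q S where b: "b = (Q, S)" "0 \<notin># Q" "finite S" "0 \<notin> S"
      and s: "int (\<Sum>S) = int n - int 1 * int (sum_mset Q)"
      by (auto simp: distinct_parts_def simp del: of_nat_sum)
    from s have "sum_mset Q + \<Sum>S = n" by linarith
    then show ?case using b
      by (auto simp: overpartitions_def partitions_def sum_mset_mset_set)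
  next
    case (5 a)
    then show ?case by (simp add: nonoverlined_def case_prod_unfold)
  qed
  also have "\<dots> = (\<Sum>k\<le>n. int (card (distinct_parts (int n - int 1 * int k))) * crank_total m k)"
    unfolding crank_total_def
    by (rule sum_Sigma_partitions) (auto simp: finite_distinct_parts distinct_parts_neg)
  finally show ?thesis by simp
qed

lemma double_half_even: "{# 2 * k. k \<in># {# k div 2. k \<in># filter_mset even P #} #} = filter_mset even P"
  for P :: "nat multiset"
  by (induction P) auto

lemma half_double: "{# k div 2. k \<in># filter_mset even {# 2 * k. k \<in># E #} #} = E"
  for E :: "nat multiset"
  by (induction E) auto

lemma odd_part_double: "filter_mset odd {# 2 * k. k \<in># E #} = {#}"
  for E :: "nat multiset"
  by (induction E) auto

lemma sum_mset_double: "sum_mset {# 2 * k. k \<in># E #} = 2 * sum_mset E"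
  for E :: "nat multiset"
  by (induction E) auto

text \<open>An overpartition splits into its even non-overlined parts, stored halved, its odd
  non-overlined parts and its overlined sizes. Halving accounts for the factor 2 in the
  argument.\<close>

lemma M2bar_convolution:
  "M2bar m n = (\<Sum>k\<le>n. int (card (odd_distinct_pairs (int n - 2 * int k))) * crank_total m k)"
proof -
  have "M2bar m n = (\<Sum>y\<in>{(E, x). 0 \<notin># E \<and> x \<in> odd_distinct_pairs (int n - int 2 * int (sum_mset E))}.
      crank_weight m (fst y))"
    unfolding M2bar_def
  proof (rule sum.reindex_bij_witness[where
        j = "\<lambda>\<pi>. (half_even_nonoverlined \<pi>, filter_mset odd (nonoverlined \<pi>), snd \<pi>)" and
        i = "\<lambda>(E, Q, S). ({# 2 * k. k \<in># E #} + Q + mset_set S, S)"], goal_cases)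
    case (1 a)
    then show ?case
      by (auto simp: overpartitions_def half_even_nonoverlined_def nonoverlined_def
          mset_set_subseteq double_half_even multiset_partition[symmetric] simp del: multiset.map_comp)
  next
    case (2 a)
    then obtain P S where a: "a = (P, S)" "0 \<notin># P" "sum_mset P = n" "S \<subseteq> set_mset P"
      by (auto simp: overpartitions_def partitions_def)
    define R where "R = P - mset_set S"
    have S: "finite S" "0 \<notin> S" using a by (auto intro: finite_subset)
    have "n = sum_mset R + \<Sum>S"
      using mset_set_subseteq[OF a(4)] a(3) unfolding R_def
      by (metis subset_mset.diff_add sum_mset.union sum_mset_mset_set)
    also have "sum_mset R = sum_mset (filter_mset even R) + sum_mset (filter_mset odd R)"
      by (metis multiset_partition sum_mset.union)
    also have "sum_mset (filter_mset even R) = 2 * sum_mset {# k div 2. k \<in># filter_mset even R #}"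
      by (metis double_half_even sum_mset_double)
    finally have "int (sum_mset (filter_mset odd R) + \<Sum>S) =
        int n - int 2 * int (sum_mset {# k div 2. k \<in># filter_mset even R #})"
      by linarith
    moreover have "0 \<notin># R" using a(2) unfolding R_def by (auto dest: in_diffD)
    then have "0 \<notin># {# k div 2. k \<in># filter_mset even R #}"
      by (auto elim!: evenE)
    ultimately show ?case using a(1) S
      by (simp add: odd_distinct_pairs_def half_even_nonoverlined_def nonoverlined_def
          R_def[symmetric] del: of_nat_sum of_nat_add set_image_mset)
  next
    case (3 b)
    then obtain E Q S where b: "b = (E, Q, S)" and Q: "\<forall>k\<in>#Q. odd k"
      by (auto simp: odd_distinct_pairs_def)
    have "filter_mset even Q = {#}" "filter_mset odd Q = Q"
      using Q by (auto simp: filter_mset_eq_conv)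
    then show ?case
      by (simp add: b half_even_nonoverlined_def nonoverlined_def half_double odd_part_double
          del: multiset.map_comp)
  next
    case (4 b)
    then obtain E Q S where b: "b = (E, Q, S)" and Q: "\<forall>k\<in>#Q. odd k" and S: "finite S" "0 \<notin> S"
      and E: "0 \<notin># E" and s: "int (sum_mset Q + \<Sum>S) = int n - int 2 * int (sum_mset E)"
      by (auto simp: odd_distinct_pairs_def simp del: of_nat_sum of_nat_add)
    from s have "2 * sum_mset E + sum_mset Q + \<Sum>S = n" by linarith
    moreover have "0 \<notin># Q" using Q by force
    moreover have "0 \<notin># {# 2 * k. k \<in># E #}" using E by auto
    ultimately show ?case using b S E
      by (simp add: overpartitions_def partitions_def sum_mset_mset_set sum_mset_double
          del: set_image_mset)
  next
    case (5 a)
    then show ?case by simp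
  qed
  also have "\<dots> = (\<Sum>k\<le>n. int (card (odd_distinct_pairs (int n - int 2 * int k))) * crank_total m k)"
    unfolding crank_total_def
    by (rule sum_Sigma_partitions) (auto simp: finite_odd_distinct_pairs odd_distinct_pairs_neg)
  finally show ?thesis by simp
qed

section \<open>Signs of the crank counts\<close>

lemma crank_total_0_0: "crank_total 0 0 = 1"
  by (simp add: crank_total_def partitions_0 crank_weight_def crank_def)

lemma crank_total_0_1: "crank_total 0 1 = -1"
  unfolding crank_total_def partitions_1 by (simp add: crank_weight_def)

lemma crank_weight_nonneg: "m \<noteq> 0 \<or> P \<noteq> {#1#} \<Longrightarrow> crank_weight m P \<ge> 0"
  by (auto simp: crank_weight_def)

text \<open>A negative weight arises only from \<open>{#1#}\<close>, only at crank 0, and this is a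
  partition of 1.\<close>

lemma crank_total_nonneg:
  assumes "m \<noteq> 0 \<or> k \<noteq> 1"
  shows "crank_total m k \<ge> 0"
  unfolding crank_total_def
  by (rule sum_nonneg, rule crank_weight_nonneg) (use assms in \<open>auto simp: partitions_def\<close>)

lemma crank_total_0_ge_1:
  assumes "k \<ge> 3"
  shows "crank_total 0 k \<ge> 1"
proof -
  define P where "P = {#k - 1, 1#}"
  have P: "P \<in> partitions k" using assms by (auto simp: P_def partitions_def)
  \<comment> \<open>The bound \<open>k \<ge> 3\<close> makes \<open>k - 1\<close> exceed the number
    of ones, so the crank is 1 - 1. For \<open>k = 2\<close> the witness would be two ones, of crank
    -2.\<close>
  have "{#x \<in># P. count P 1 < x#} = {#k - 1#}" "count P 1 = 1"
    using assms by (auto simp: P_def)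
  then have "crank P = 0" using assms by (simp add: crank_def) (simp add: P_def)
  then have "crank_weight 0 P = 1" by (simp add: crank_weight_def P_def)
  moreover have "crank_weight 0 P \<le> crank_total 0 k"
    unfolding crank_total_def
    by (rule member_le_sum[OF P], rule crank_weight_nonneg)
      (use assms in \<open>auto simp: partitions_def intro: finite_partitions[unfolded partitions_def]\<close>)
  ultimately show ?thesis by simp
qed

section \<open>Raising the largest part\<close>

text \<open>Inserting 0 lets \<open>raise_max j\<close> send the empty set to \<open>{j}\<close>.\<close>

definition raise_max :: "nat \<Rightarrow> nat set \<Rightarrow> nat set" where
  "raise_max j S = insert (Max (insert 0 S) + j) (S - {Max (insert 0 S)})"

text \<open>The side conditions exclude two effects at the empty set: \<open>raise_max 0 {}\<close>
  is \<open>{0}\<close>, and the cardinality grows from 0 to 1.\<close>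

lemma raise_max_props:
  assumes "finite S" "0 \<notin> S"
  shows finite_raise_max: "finite (raise_max j S)"
    and raise_max_fresh: "Max (insert 0 S) + j \<notin> S - {Max (insert 0 S)}"
    and sum_raise_max: "\<Sum>(raise_max j S) = \<Sum>S + j"
    and zero_notin_raise_max: "j > 0 \<or> S \<noteq> {} \<Longrightarrow> 0 \<notin> raise_max j S"
    and card_raise_max: "S \<noteq> {} \<Longrightarrow> card (raise_max j S) = card S"
    and Max_raise_max: "Max (raise_max j S) = Max (insert 0 S) + j"
proof -
  let ?M = "Max (insert 0 S)"
  have le: "x \<le> ?M" if "x \<in> S" for x using assms that by simp
  show fin: "finite (raise_max j S)" using assms by (simp add: raise_max_def)
  \<comment> \<open>No element of \<open>S\<close> exceeds \<open>?M\<close>; for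
    \<open>j = 0\<close> the claim holds because \<open>?M\<close> itself has been removed.\<close>
  show fresh: "?M + j \<notin> S - {?M}" using le by fastforce
  show Max: "Max (raise_max j S) = ?M + j"
    by (rule Max_eqI) (use fin le in \<open>fastforce simp: raise_max_def\<close>)+
  have M: "?M \<in> S" if "S \<noteq> {}"
    using assms that by (metis Max_in Max_insert finite.insertI insertE insert_not_empty max_0L)
  have "\<Sum>(raise_max j S) = ?M + j + \<Sum>(S - {?M})"
    unfolding raise_max_def using assms fresh by simp
  moreover have "?M + \<Sum>(S - {?M}) = \<Sum>S"
  proof (cases "S = {}")
    case False
    then show ?thesis using sum.remove[OF assms(1) M, of "\<lambda>x. x"] by simp
  qed simp
  ultimately show "\<Sum>(raise_max j S) = \<Sum>S + j" by simp
  show "0 \<notin> raise_max j S" if "j > 0 \<or> S \<noteq> {}"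
  proof -
    have "?M + j \<noteq> 0"
    proof (cases "S = {}")
      case False
      then have "?M \<noteq> 0" using M assms(2) by force
      then show ?thesis by simp
    qed (use that in simp)
    then show ?thesis using assms(2) by (simp add: raise_max_def del: Max_insert)
  qed
  show "card (raise_max j S) = card S" if "S \<noteq> {}"
    unfolding raise_max_def using assms fresh card_Suc_Diff1[OF assms(1) M[OF that]] by simp
qed

text \<open>The new maximum minus \<open>j\<close> is the old one, and the remaining elements are
  unchanged.\<close>

lemma raise_max_inject:
  assumes "finite S" "0 \<notin> S" "finite T" "0 \<notin> T" "raise_max j S = raise_max j T"
  shows "S = T"
proof -
  have M: "Max (insert 0 S) = Max (insert 0 T)"
    using Max_raise_max[OF assms(1,2), of j] Max_raise_max[OF assms(3,4), of j] assms(5) by simp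
  have "S - {Max (insert 0 S)} = T - {Max (insert 0 T)}"
    using assms(5) raise_max_fresh[OF assms(1,2), of j] raise_max_fresh[OF assms(3,4), of j]
    unfolding raise_max_def M by (metis Diff_insert_absorb)
  \<comment> \<open>With 0 inserted on both sides, the empty set, whose maximum 0 is not an element,
    needs no separate case.\<close>
  moreover have "insert 0 (U - {Max (insert 0 U)}) \<union> {Max (insert 0 U)} = insert 0 U"
    if "finite U" for U :: "nat set"
    using Max_in[of "insert 0 U"] that by auto
  ultimately have "insert 0 S = insert 0 T" using M assms by metis
  then show ?thesis using assms(2,4) by (simp add: insert_ident)
qed

section \<open>Growth of the numbers of distinct partitions and of pairs\<close>

text \<open>Raising the largest part by 1 is injective; the empty set goes to
  \<open>{1}\<close>.\<close>

lemma card_distinct_parts_mono: "card (distinct_parts (j - 1)) \<le> card (distinct_parts j)"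
proof (rule card_inj_on_le[where f = "raise_max 1"])
  show "inj_on (raise_max 1) (distinct_parts (j - 1))"
    by (rule inj_onI, rule raise_max_inject) (auto simp: distinct_parts_def)
  show "raise_max 1 ` distinct_parts (j - 1) \<subseteq> distinct_parts j"
    unfolding distinct_parts_def
    by (auto simp: finite_raise_max sum_raise_max zero_notin_raise_max simp del: of_nat_sum)
qed (rule finite_distinct_parts)

text \<open>Partitions into distinct parts containing 1 lose that part. In one with \<open>k\<close> parts, none
  equal to 1, every part is lowered by 1, and the surplus \<open>k - 2\<close> is returned to the largest part.\<close>

lemma card_distinct_parts_le:
  assumes "j \<ge> 1"
  shows "card (distinct_parts j) \<le> card (distinct_parts (j - 1)) + card (distinct_parts (j - 2))"
proof -
  let ?A = "{S \<in> distinct_parts j. 1 \<in> S}" and ?B = "{S \<in> distinct_parts j. 1 \<notin> S}"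
  have "card ?A \<le> card (distinct_parts (j - 1))"
  proof (rule card_inj_on_le[where f = "\<lambda>S. S - {1}"])
    show "inj_on (\<lambda>S. S - {1}) ?A" by (rule inj_onI) blast
    show "(\<lambda>S. S - {1}) ` ?A \<subseteq> distinct_parts (j - 1)"
    proof clarify
      fix S assume S: "S \<in> distinct_parts j" "1 \<in> S"
      then have "\<Sum>S = 1 + \<Sum>(S - {1})"
        using sum.remove[of S 1 "\<lambda>x. x"] by (simp add: distinct_parts_def)
      then show "S - {1} \<in> distinct_parts (j - 1)"
        using S by (auto simp: distinct_parts_def simp del: of_nat_sum)
    qed
  qed (rule finite_distinct_parts)
  moreover have "card ?B \<le> card (distinct_parts (j - 2))"
  proof -
    \<comment> \<open>For a single part \<open>card S - 2\<close> truncates to 0, so that part is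
      lowered by 2 directly. Removing 0 sends \<open>{2}\<close> to the empty set.\<close>
    define f where "f S = (if card S = 1 then {nat j - 2} - {0}
      else raise_max (card S - 2) ((\<lambda>x. x - 1) ` S))" for S
    \<comment> \<open>Here \<open>j \<ge> 1\<close> gives \<open>S \<noteq> {}\<close>. At
      \<open>j = 0\<close> the empty set would be counted, and the bound would read 1 \<le>
      0.\<close>
    have B: "finite S" "0 \<notin> S" "1 \<notin> S" "S \<noteq> {}" "int (\<Sum>S) = j" if "S \<in> ?B" for S
      using that assms by (auto simp: distinct_parts_def)
    have single: "S = {nat j} \<and> nat j \<ge> 2" if S: "S \<in> ?B" "card S = 1" for S
    proof -
      obtain a where a: "S = {a}" using S(2) by (auto simp: card_1_singleton_iff)
      then have "a \<noteq> 0" "a \<noteq> 1" "nat j = a" using B[OF S(1)] by auto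
      then show ?thesis using a by simp
    qed
    have inj: "inj_on (\<lambda>x. x - 1) S" if "S \<in> ?B" for S
      by (rule inj_onI) (use B[OF that] in \<open>metis One_nat_def Suc_pred not_gr_zero\<close>)
    have low: "finite ((\<lambda>x. x - 1) ` S)" "0 \<notin> (\<lambda>x. x - 1) ` S" "(\<lambda>x. x - 1) ` S \<noteq> {}"
      "card ((\<lambda>x. x - 1) ` S) = card S" "\<Sum>((\<lambda>x. x - 1) ` S) + card S = \<Sum>S"
      if S: "S \<in> ?B" for S
    proof -
      show "finite ((\<lambda>x. x - 1) ` S)" "(\<lambda>x. x - 1) ` S \<noteq> {}" using B[OF S] by auto
      show "0 \<notin> (\<lambda>x. x - 1) ` S"
      proof
        assume "0 \<in> (\<lambda>x. x - 1) ` S"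
        then obtain x where "x \<in> S" "x = 0 \<or> x = 1" by force
        then show False using B[OF S] by blast
      qed
      show "card ((\<lambda>x. x - 1) ` S) = card S" by (rule card_image[OF inj[OF S]])
      have "\<Sum>((\<lambda>x. x - 1) ` S) + card S = (\<Sum>x\<in>S. (x - 1) + 1)"
        by (subst sum.reindex[OF inj[OF S]]) (simp only: o_def sum.distrib card_eq_sum)
      also have "\<dots> = \<Sum>S"
        by (rule sum.cong) (use B[OF S] in \<open>auto, metis Suc_pred not_gr_zero\<close>)
      finally show "\<Sum>((\<lambda>x. x - 1) ` S) + card S = \<Sum>S" .
    qed
    \<comment> \<open>The cardinality of \<open>f S\<close> tells the two cases of \<open>f\<close>
      apart and, in the second, recovers the amount \<open>card S - 2\<close> by which the maximum
      was raised.\<close>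
    have card_f: "card (f S) = card S" if "S \<in> ?B" "card S \<noteq> 1" for S
      using that low[OF that(1)] by (simp add: f_def card_raise_max)
    have card_f1: "card (f S) \<le> 1" if "S \<in> ?B" "card S = 1" for S
      using that by (simp add: f_def card_Diff_singleton_if)
    have pos: "card S \<ge> 1" if "S \<in> ?B" for S
      using B[OF that] by (simp add: Suc_le_eq card_gt_0_iff)
    show ?thesis
    proof (rule card_inj_on_le[where f = f])
      show "inj_on f ?B"
      proof (rule inj_onI)
        fix S T assume S: "S \<in> ?B" and T: "T \<in> ?B" and eq: "f S = f T"
        show "S = T"
        proof (cases "card S = 1 \<or> card T = 1")
          case True
          then have "card S = 1 \<and> card T = 1"
            using card_f[OF S] card_f[OF T] card_f1[OF S] card_f1[OF T] pos[OF S] pos[OF T] eq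
            by (metis le_antisym)
          then show ?thesis using single S T by metis
        next
          case False
          then have "card S = card T" using card_f[OF S] card_f[OF T] eq by simp
          then have "raise_max (card T - 2) ((\<lambda>x. x - 1) ` S) = raise_max (card T - 2) ((\<lambda>x. x - 1) ` T)"
            using eq False by (simp add: f_def)
          then have "(\<lambda>x. x - 1) ` S = (\<lambda>x. x - 1) ` T"
            by (rule raise_max_inject[OF low(1,2)[OF S] low(1,2)[OF T]])
          then have "Suc ` (\<lambda>x. x - 1) ` S = Suc ` (\<lambda>x. x - 1) ` T" by simp
          moreover have "Suc ` (\<lambda>x. x - 1) ` U = U" if "U \<in> ?B" for U
          proof -
            have "Suc (x - 1) = x" if "x \<in> U" for x
              using B(2)[OF \<open>U \<in> ?B\<close>] that by (cases x) auto
            then show ?thesis by (simp add: image_image)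
          qed
          ultimately show ?thesis using S T by metis
        qed
      qed
      show "f ` ?B \<subseteq> distinct_parts (j - 2)"
      proof (rule image_subsetI)
        fix S assume S: "S \<in> ?B"
        show "f S \<in> distinct_parts (j - 2)"
        proof (cases "card S = 1")
          case True
          then have "nat j \<ge> 2" using single S by blast
          then show ?thesis using True by (cases "nat j = 2") (auto simp: f_def distinct_parts_def)
        next
          case False
          then have "card S \<ge> 2" using pos[OF S] by linarith
          then have "\<Sum>(f S) + 2 = \<Sum>S"
            using False low(5)[OF S] sum_raise_max[OF low(1,2)[OF S]] by (simp add: f_def)
          then have "int (\<Sum>(f S)) = j - 2" using B(5)[OF S] by linarith
          then show ?thesis
            using False low[OF S] by (simp add: distinct_parts_def f_def finite_raise_max
                zero_notin_raise_max del: of_nat_sum)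
        qed
      qed
    qed (rule finite_distinct_parts)
  qed
  moreover have "card (distinct_parts j) = card ?A + card ?B"
    by (subst card_Un_disjoint[symmetric])
      (auto simp: finite_distinct_parts intro: arg_cong[where f = card])
  ultimately show ?thesis by linarith
qed

text \<open>Inserting an odd part 1 is a bijection onto the pairs that have one.\<close>

lemma card_odd_distinct_pairs_step:
  "card (odd_distinct_pairs j) =
    card (odd_distinct_pairs (j - 1)) + card {x \<in> odd_distinct_pairs j. 1 \<notin># fst x}"
proof -
  let ?A = "{x \<in> odd_distinct_pairs j. 1 \<in># fst x}"
  have "bij_betw (\<lambda>(Q, S). (add_mset 1 Q, S)) (odd_distinct_pairs (j - 1)) ?A"
  proof (rule bij_betw_byWitness[where f' = "\<lambda>(Q, S). (Q - {#1#}, S)"])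
    show "(\<lambda>(Q, S). (add_mset 1 Q, S)) ` odd_distinct_pairs (j - 1) \<subseteq> ?A"
    proof (rule image_subsetI)
      fix x assume "x \<in> odd_distinct_pairs (j - 1)"
      then obtain Q S where x: "x = (Q, S)" "\<forall>k\<in>#Q. odd k" "finite S" "0 \<notin> S"
        and s: "int (sum_mset Q + \<Sum>S) = j - 1"
        unfolding odd_distinct_pairs_def by blast
      from s have "int (sum_mset (add_mset 1 Q) + \<Sum>S) = j" by simp
      then show "(\<lambda>(Q, S). (add_mset 1 Q, S)) x \<in> ?A"
        using x unfolding odd_distinct_pairs_def by simp
    qed
    show "(\<lambda>(Q, S). (Q - {#1#}, S)) ` ?A \<subseteq> odd_distinct_pairs (j - 1)"
    proof (rule image_subsetI)
      fix x assume "x \<in> ?A"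
      then obtain Q S where x: "x = (add_mset 1 Q, S)" "\<forall>k\<in>#add_mset 1 Q. odd k" "finite S" "0 \<notin> S"
        and s: "int (sum_mset (add_mset 1 Q) + \<Sum>S) = j"
        unfolding odd_distinct_pairs_def by (auto dest!: multi_member_split simp del: of_nat_add)
      from s have "int (sum_mset Q + \<Sum>S) = j - 1" by simp
      then show "(\<lambda>(Q, S). (Q - {#1#}, S)) x \<in> odd_distinct_pairs (j - 1)"
        using x unfolding odd_distinct_pairs_def by simp
    qed
  qed auto
  then have "card (odd_distinct_pairs (j - 1)) = card ?A"
    by (rule bij_betw_same_card)
  moreover have "card (odd_distinct_pairs j) = card ?A + card {x \<in> odd_distinct_pairs j. 1 \<notin># fst x}"
    by (subst card_Un_disjoint[symmetric])
      (auto simp: finite_odd_distinct_pairs intro: arg_cong[where f = card])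
  ultimately show ?thesis by simp
qed

text \<open>The injection changes only the distinct parts, so the odd parts still avoid 1; an empty
  set of distinct parts becomes \<open>{2}\<close>.\<close>

lemma card_odd_distinct_pairs_no_1_mono:
  "card {x \<in> odd_distinct_pairs (j - 2). 1 \<notin># fst x} \<le> card {x \<in> odd_distinct_pairs j. 1 \<notin># fst x}"
proof (rule card_inj_on_le[where f = "map_prod id (raise_max 2)"])
  show "inj_on (map_prod id (raise_max 2)) {x \<in> odd_distinct_pairs (j - 2). 1 \<notin># fst x}"
  proof (rule inj_onI)
    fix x y
    assume "x \<in> {x \<in> odd_distinct_pairs (j - 2). 1 \<notin># fst x}"
      and "y \<in> {x \<in> odd_distinct_pairs (j - 2). 1 \<notin># fst x}"
      and eq: "map_prod id (raise_max 2) x = map_prod id (raise_max 2) y"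
    then have "finite (snd x)" "0 \<notin> snd x" "finite (snd y)" "0 \<notin> snd y"
      unfolding odd_distinct_pairs_def by force+
    moreover have "raise_max 2 (snd x) = raise_max 2 (snd y)" using eq by (simp add: prod_eq_iff)
    ultimately have "snd x = snd y" by (rule raise_max_inject)
    then show "x = y" using eq by (simp add: prod_eq_iff)
  qed
  show "map_prod id (raise_max 2) ` {x \<in> odd_distinct_pairs (j - 2). 1 \<notin># fst x}
      \<subseteq> {x \<in> odd_distinct_pairs j. 1 \<notin># fst x}"
  proof (rule image_subsetI)
    fix x assume "x \<in> {x \<in> odd_distinct_pairs (j - 2). 1 \<notin># fst x}"
    then obtain Q S where x: "x = (Q, S)" "\<forall>k\<in>#Q. odd k" "finite S" "0 \<notin> S" "1 \<notin># Q"
      and s: "int (sum_mset Q + \<Sum>S) = j - 2"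
      unfolding odd_distinct_pairs_def by (cases x) simp
    from s have "int (sum_mset Q + \<Sum>(raise_max 2 S)) = j"
      unfolding sum_raise_max[OF x(3,4)] by simp
    then show "map_prod id (raise_max 2) x \<in> {x \<in> odd_distinct_pairs j. 1 \<notin># fst x}"
      using x unfolding odd_distinct_pairs_def
      by (simp add: finite_raise_max zero_notin_raise_max del: of_nat_sum of_nat_add)
  qed
qed (simp add: finite_odd_distinct_pairs)

section \<open>Monotonicity of both residual crank counts\<close>

lemma Mbar_mono:
  assumes "n \<ge> 1" "(m, n) \<noteq> (0, 1)"
  shows "Mbar m (n - 1) \<le> Mbar m n"
proof -
  define D where "D j = int (card (distinct_parts j))" for j
  define d where "d j = D j - D (j - 1)" for j
  have d_nonneg: "d j \<ge> 0" for j
    using card_distinct_parts_mono[of j] by (simp add: d_def D_def)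
  have D_neg: "D j = 0" if "j < 0" for j using that by (simp add: D_def distinct_parts_neg)
  \<comment> \<open>The sum for \<open>n - 1\<close> is extended to \<open>k = n\<close> by the term
    with \<open>D (-1) = 0\<close>, so that both sums have the same range.\<close>
  have "{..n} = insert n {..n - 1}" using assms(1) by auto
  then have "Mbar m (n - 1) = (\<Sum>k\<le>n. D (int n - int k - 1) * crank_total m k)"
    using assms(1) D_neg[of "-1"]
    by (simp add: Mbar_convolution D_def[symmetric] of_nat_diff algebra_simps)
  then have diff: "Mbar m n - Mbar m (n - 1) = (\<Sum>k\<le>n. d (int n - int k) * crank_total m k)"
    by (simp add: Mbar_convolution D_def[symmetric] d_def left_diff_distrib sum_subtractf)
  show ?thesis
  proof (cases "m = 0")
    case False
    then have "(\<Sum>k\<le>n. d (int n - int k) * crank_total m k) \<ge> 0"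
      by (intro sum_nonneg mult_nonneg_nonneg d_nonneg crank_total_nonneg) auto
    then show ?thesis using diff by simp
  next
    case True
    \<comment> \<open>At \<open>n = 1\<close> the difference would be
      \<open>d 1 - d 0 = -1\<close>.\<close>
    then have n: "n \<ge> 2" using assms by force
    have split: "{..n} = {0, 1, 2} \<union> {3..n}" using n by auto
    \<comment> \<open>The far end of the telescope is \<open>D (-1) = 0\<close>. For
      \<open>n = 2\<close> the sum is empty and \<open>D (n - 3)\<close> vanishes as well.\<close>
    have tel: "(\<Sum>k=3..n. d (int n - int k)) = D (int n - 3)"
    proof -
      have "(\<Sum>k=3..<Suc N. d (int n - int k)) = D (int n - 3) - D (int n - int N - 1)" if "N \<ge> 2" for N
        using that by (induction N rule: dec_induct) (simp_all add: d_def algebra_simps)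
      from this[of n] show ?thesis using n D_neg[of "-1"] by (simp add: atLeastLessThanSuc_atLeastAtMost)
    qed
    have "(\<Sum>k\<le>n. d (int n - int k) * crank_total 0 k) = d (int n) - d (int n - 1)
        + d (int n - 2) * crank_total 0 2 + (\<Sum>k=3..n. d (int n - int k) * crank_total 0 k)"
      unfolding split by (subst sum.union_disjoint)
        (auto simp: crank_total_0_0 crank_total_0_1[unfolded One_nat_def])
    moreover have "d (int n - 2) * crank_total 0 2 \<ge> 0"
      by (intro mult_nonneg_nonneg d_nonneg crank_total_nonneg) simp
    moreover have "(\<Sum>k=3..n. d (int n - int k) * crank_total 0 k) \<ge> (\<Sum>k=3..n. d (int n - int k))"
      by (rule sum_mono) (simp add: mult_le_cancel_left1 crank_total_0_ge_1 d_nonneg not_less[THEN iffD2])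
    \<comment> \<open>Since \<open>d (n - 1) = D (n - 1) - D (n - 2)\<close>, this says that the
      telescoped sum \<open>D (n - 3)\<close> pays for the negative term.\<close>
    moreover have "D (int n - 1) \<le> D (int n - 2) + D (int n - 3)"
      using card_distinct_parts_le[of "int n - 1"] n by (simp add: D_def)
    ultimately show ?thesis
      using diff tel True d_nonneg[of "int n"] by (simp add: d_def)
  qed
qed

lemma M2bar_mono:
  assumes "n \<ge> 1"
  shows "M2bar m (n - 1) \<le> M2bar m n"
proof -
  define B where "B j = int (card (odd_distinct_pairs j))" for j
  define b where "b j = B j - B (j - 1)" for j
  have b: "b j = int (card {x \<in> odd_distinct_pairs j. 1 \<notin># fst x})" for j
    using card_odd_distinct_pairs_step[of j] by (simp add: b_def B_def)
  have b_nonneg: "b j \<ge> 0" for j by (simp add: b)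
  have B_neg: "B j = 0" if "j < 0" for j using that by (simp add: B_def odd_distinct_pairs_neg)
  \<comment> \<open>The added term \<open>k = n\<close> has argument \<open>-1 - n\<close>, where
    \<open>B\<close> vanishes.\<close>
  have "{..n} = insert n {..n - 1}" using assms by auto
  then have "M2bar m (n - 1) = (\<Sum>k\<le>n. B (int n - 2 * int k - 1) * crank_total m k)"
    using assms B_neg[of "- 1 - int n"]
    by (simp add: M2bar_convolution B_def[symmetric] of_nat_diff algebra_simps)
  then have diff: "M2bar m n - M2bar m (n - 1) = (\<Sum>k\<le>n. b (int n - 2 * int k) * crank_total m k)"
    by (simp add: M2bar_convolution B_def[symmetric] b_def left_diff_distrib sum_subtractf)
  also have "\<dots> \<ge> 0"
  proof (cases "m = 0")
    case False
    then show ?thesis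
      by (intro sum_nonneg mult_nonneg_nonneg b_nonneg crank_total_nonneg) auto
  next
    case True
    \<comment> \<open>Only the terms at 0 and 1 need comparing. For \<open>n = 1\<close> the
      negative one is \<open>b (-1) = 0\<close>, so no exception arises here.\<close>
    have split: "{..n} = {0, 1} \<union> {2..n}" using assms by auto
    have "(\<Sum>k\<le>n. b (int n - 2 * int k) * crank_total 0 k) = b (int n) - b (int n - 2)
        + (\<Sum>k=2..n. b (int n - 2 * int k) * crank_total 0 k)"
      unfolding split by (subst sum.union_disjoint)
        (auto simp: crank_total_0_0 crank_total_0_1[unfolded One_nat_def])
    moreover have "(\<Sum>k=2..n. b (int n - 2 * int k) * crank_total 0 k) \<ge> 0"
      by (intro sum_nonneg mult_nonneg_nonneg b_nonneg crank_total_nonneg) auto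
    moreover have "b (int n - 2) \<le> b (int n)"
      unfolding b using card_odd_distinct_pairs_no_1_mono[of "int n"] by simp
    ultimately show ?thesis using True by simp
  qed
  finally show ?thesis by simp
qed

theorem theorem1p7:
  fixes m :: int and n :: nat
  assumes "m \<ge> 0" and "n \<ge> 1"
  shows "((m, n) \<noteq> (0, 1) \<longrightarrow> Mbar m n \<ge> Mbar m (n - 1)) \<and> M2bar m n \<ge> M2bar m (n - 1)"
  using Mbar_mono M2bar_mono assms(2) by blast

end
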